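(* Let $C$ be a convex, bounded subset of $\mathbb{R}^n$, and let $P_1, \dots, P_k$ ($k\ge 1$) be planks in $\mathbb{R}^n$, with directions $v_1,\dots,v_k$ and widths $w_1,\dots,w_k$ respectively, which cover $C$, i.e. $C \subseteq \bigcup_{i=1}^k P_i$. Assume that for every $m$ with $1 \leq m \leq k$ the set $$ C \setminus \bigcup_{i=1}^m P_i $$ is convex. Then $$ \sum_{i=1}^k \frac{w_i}{w_{v_i}(C)} \geq 1. $$
   Context: A plank $P$ in $\mathbb{R}^n$ is the closed, connected region between two parallel hyperplanes, i.e. a set $\{x : a \le \langle u,x\rangle \le b\}$ with $u$ a unit vector and $a\le b$ real. Its width is the distance $b-a$ between the two hyperplanes, and its direction is the one-dimensional linear subspace $v=\mathbb{R}u$ of $\mathbb{R}^n$ perpendicular to them. For a one-dimensional linear subspace $v=\mathbb{R}u$ ($|u|=1$) and a bounded convex set $K$, $w_v(K)$ denotes the width of the smallest plank of direction $v$ which covers $K$; for nonempty $K$ this equals $\sup_{x\in K}\langle u,x\rangle-\inf_{x\in K}\langle u,x\rangle$, and it is $0$ for $K=\varnothing$. The empty set counts as convex. Convention: if $w_{v_i}(C)=0$, the ratio $\frac{w_i}{w_{v_i}(C)}$ is defined to be $+\infty$ (so the inequality holds trivially). *)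

theory Defs
  imports "HOL-Analysis.Analysis" "HOL-Library.Extended_Real"
begin

text \<open>
  \<open>plank P v w\<close>: the set \<open>P\<close> is a plank of direction \<open>v\<close> (a one-dimensional linear
  subspace) and width \<open>w\<close>. Both \<open>v\<close> and \<open>w\<close> are uniquely determined by \<open>P\<close>. Degenerate
  planks (\<open>a = b\<close>, a single hyperplane) are allowed.
\<close>

definition plank :: "(real ^ 'n) set \<Rightarrow> (real ^ 'n) set \<Rightarrow> real \<Rightarrow> bool" where
  "plank P v w \<longleftrightarrow>
     (\<exists>u a b. norm u = 1 \<and> a \<le> b \<and> P = {x. a \<le> u \<bullet> x \<and> u \<bullet> x \<le> b} \<and>
              v = span {u} \<and> w = b - a)"

text \<open>
  For a line \<open>v\<close> through the origin and a bounded set \<open>K\<close>, the set of widths below is nonempty,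
  bounded below by 0, and its infimum is attained (with value 0 for \<open>K = {}\<close>).
\<close>

definition width_in_direction :: "(real ^ 'n) set \<Rightarrow> (real ^ 'n) set \<Rightarrow> real" where
  "width_in_direction v K = Inf {w. \<exists>P. plank P v w \<and> K \<subseteq> P}"

text \<open>
  The case distinction is needed because \<open>0 / 0 = 0\<close> on the extended reals, whereas the
  convention here is that the ratio is infinite whenever the denominator vanishes.
\<close>

definition relative_width :: "real \<Rightarrow> (real ^ 'n) set \<Rightarrow> (real ^ 'n) set \<Rightarrow> ereal" where
  "relative_width w v C =
     (if width_in_direction v C = 0 then \<infinity> else ereal (w / width_in_direction v C))"

end

theory Submission
  imports Defs
begin

text \<open>
  Track the size of a homothetic copy \<open>t + \<rho> C\<close> of the body that survives the removal of the
  planks one after another. At the start copies of every size \<open>\<rho> \<le> 1\<close> fit into \<open>C\<close>. If the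
  set left after removing a plank is convex, then it cannot have points on both sides of the
  plank, so the copy does not stick out of the plank on one of its sides, say below. Shrink the
  copy towards its (almost) highest point so that its size \<open>\<rho>\<close> drops by slightly more than
  \<open>w / W\<close>, where \<open>W\<close> is the width of \<open>C\<close> in the direction of the plank. This keeps it inside the
  old copy and raises its lower end by more than \<open>w\<close>, so the new copy lies strictly above the plank
  (\<open>homothet_survives_plank\<close>). A plank therefore costs at most its relative width,
  up to an arbitrarily small loss (\<open>homothet_survives_planks\<close>). If the relative widths summed to
  less than 1, then a copy of size 0, that is, a point, would survive all planks, and the
  planks would not cover \<open>C\<close>. Here \<open>C\<close> must be nonempty with nonzero width in each of the
  directions; otherwise one of the relative widths is infinite by convention.
\<close>

section \<open>Width of a bounded set in a direction\<close>

lemma plank_width_nonneg: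
  assumes "plank P v w"
  shows "0 \<le> w"
  using assms by (auto simp: plank_def)

lemma width_in_direction_le:
  assumes "plank P v w" "K \<subseteq> P"
  shows "width_in_direction v K \<le> w"
  unfolding width_in_direction_def
proof (rule cInf_lower)
  show "bdd_below {w. \<exists>P. plank P v w \<and> K \<subseteq> P}"
    by (rule bdd_belowI[of _ 0]) (auto intro: plank_width_nonneg)
qed (use assms in blast)

text \<open>
  The infimum over an empty set of reals is unspecified, so boundedness is what provides
  some plank in the given direction that covers \<open>K\<close>.
\<close>

lemma width_in_direction_nonneg:
  fixes u :: "real ^ 'n"
  assumes "bounded K" "norm u = 1"
  shows "0 \<le> width_in_direction (span {u}) K"
  unfolding width_in_direction_def
proof (rule cInf_greatest)
  obtain B where B: "B > 0" "\<And>x. x \<in> K \<Longrightarrow> norm x \<le> B"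
    using assms(1) bounded_pos by blast
  have "\<bar>u \<bullet> x\<bar> \<le> B" if "x \<in> K" for x
    using Cauchy_Schwarz_ineq2[of u x] assms(2) B(2)[OF that] by simp
  then have "K \<subseteq> {x. - B \<le> u \<bullet> x \<and> u \<bullet> x \<le> B}"
    by (fastforce simp: abs_le_iff)
  moreover have "plank {x. - B \<le> u \<bullet> x \<and> u \<bullet> x \<le> B} (span {u}) (B - - B)"
    unfolding plank_def using assms(2) B(1)
    by (intro exI[of _ u] exI[of _ "- B"] exI[of _ B]) auto
  ultimately show "{w. \<exists>P. plank P (span {u}) w \<and> K \<subseteq> P} \<noteq> {}"
    by blast
qed (auto intro: plank_width_nonneg)

text \<open>
  Working with a pair of points that nearly realises the width avoids any choice of
  extreme points, which need not exist because \<open>K\<close> need not be closed.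
\<close>

lemma points_nearly_realising_width:
  fixes u :: "real ^ 'n"
  assumes "norm u = 1" "0 \<le> g" "g < width_in_direction (span {u}) K"
  obtains c d where "c \<in> K" "d \<in> K" "g < u \<bullet> c - u \<bullet> d"
proof (rule ccontr)
  assume "\<not> thesis"
  with that have gap: "u \<bullet> x - u \<bullet> y \<le> g" if "x \<in> K" "y \<in> K" for x y
    using \<open>x \<in> K\<close> \<open>y \<in> K\<close> by (meson not_le)
  have "\<exists>a. \<forall>x\<in>K. a \<le> u \<bullet> x \<and> u \<bullet> x \<le> a + g"
  proof (cases "K = {}")
    case False
    then obtain z where z: "z \<in> K"
      by blast
    have "bdd_below ((\<bullet>) u ` K)"
      using gap[OF z] by (intro bdd_belowI[of _ "u \<bullet> z - g"]) force
    then have "Inf ((\<bullet>) u ` K) \<le> u \<bullet> x" if "x \<in> K" for x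
      using that by (auto intro: cInf_lower)
    moreover have "u \<bullet> x - g \<le> Inf ((\<bullet>) u ` K)" if "x \<in> K" for x
      using gap[OF that] False by (intro cInf_greatest) (force simp: algebra_simps)+
    ultimately show ?thesis
      by (intro exI[of _ "Inf ((\<bullet>) u ` K)"]) (auto simp: algebra_simps)
  qed auto
  then obtain a where a: "K \<subseteq> {x. a \<le> u \<bullet> x \<and> u \<bullet> x \<le> a + g}"
    by blast
  have "plank {x. a \<le> u \<bullet> x \<and> u \<bullet> x \<le> a + g} (span {u}) g"
    unfolding plank_def using assms(1,2)
    by (intro exI[of _ u] exI[of _ a] exI[of _ "a + g"]) auto
  from width_in_direction_le[OF this a] assms(3) show False
    by simp
qed

lemma width_in_direction_empty:
  fixes P :: "(real ^ 'n) set"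
  assumes "plank P v w"
  shows "width_in_direction v ({} :: (real ^ 'n) set) = 0"
proof -
  obtain u :: "real ^ 'n" where u: "norm u = 1" "v = span {u}"
    using assms by (auto simp: plank_def)
  then have "plank {x. 0 \<le> u \<bullet> x \<and> u \<bullet> x \<le> 0} v 0"
    unfolding plank_def by (intro exI[of _ u] exI[of _ 0]) auto
  from width_in_direction_le[OF this empty_subsetI]
    and width_in_direction_nonneg[OF bounded_empty u(1)] show ?thesis
    unfolding u(2) by simp
qed

section \<open>Homothetic copies surviving the removal of planks\<close>

text \<open>
  The copy is shrunk towards its image of \<open>c\<close>. A point with \<open>u \<bullet> x \<ge> u \<bullet> d\<close> ends up at
  least as high as the image of \<open>d\<close> does, and that image has been raised by
  \<open>(\<rho> - \<mu>) (u \<bullet> c - u \<bullet> d)\<close>; a point with \<open>u \<bullet> x < u \<bullet> d\<close> has been raised even more.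
\<close>

lemma shrunken_homothet_above:
  fixes C K :: "'a::real_inner set"
  assumes C: "convex C" "c \<in> C" "d \<in> C"
    and \<mu>: "0 \<le> \<mu>" "\<mu> < \<rho>"
    and K: "(\<lambda>x. t + \<rho> *\<^sub>R x) ` C \<subseteq> K"
    and above: "\<And>x. x \<in> C \<Longrightarrow> a \<le> u \<bullet> (t + \<rho> *\<^sub>R x)"
    and gap: "b - a < (\<rho> - \<mu>) * (u \<bullet> c - u \<bullet> d)"
  shows "\<exists>s. (\<lambda>x. s + \<mu> *\<^sub>R x) ` C \<subseteq> K \<inter> {y. b < u \<bullet> y}"
proof (intro exI image_subsetI IntI CollectI)
  fix x assume x: "x \<in> C"
  let ?y = "(\<mu> / \<rho>) *\<^sub>R x + ((\<rho> - \<mu>) / \<rho>) *\<^sub>R c"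
  have "?y \<in> C"
    using C \<mu> x by (intro convexD) (auto simp: field_simps)
  moreover have "t + \<rho> *\<^sub>R ?y = t + (\<rho> - \<mu>) *\<^sub>R c + \<mu> *\<^sub>R x"
    using \<mu> by (simp add: scaleR_add_right)
  ultimately show "t + (\<rho> - \<mu>) *\<^sub>R c + \<mu> *\<^sub>R x \<in> K"
    using K by (metis image_subset_iff)
  show "b < u \<bullet> (t + (\<rho> - \<mu>) *\<^sub>R c + \<mu> *\<^sub>R x)"
  proof (cases "u \<bullet> d \<le> u \<bullet> x")
    case True
    then have "\<mu> * (u \<bullet> d) \<le> \<mu> * (u \<bullet> x)"
      using \<mu> by (intro mult_left_mono)
    with above[OF \<open>d \<in> C\<close>] gap show ?thesis
      by (simp add: algebra_simps)
  next
    case False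
    then have "(\<rho> - \<mu>) * (u \<bullet> x) \<le> (\<rho> - \<mu>) * (u \<bullet> d)"
      using \<mu> by (intro mult_left_mono) auto
    with above[OF x] gap show ?thesis
      by (simp add: algebra_simps)
  qed
qed

text \<open>
  A segment joining points on different sides of the plank would cross the plank, although it
  stays in the convex set from which the plank has been removed.
\<close>

lemma convex_diff_plank_one_sided:
  fixes K :: "'a::real_inner set"
  assumes conv: "convex (K - {x. a \<le> u \<bullet> x \<and> u \<bullet> x \<le> b})" and "a \<le> b"
  shows "(\<forall>x\<in>K. a \<le> u \<bullet> x) \<or> (\<forall>x\<in>K. u \<bullet> x \<le> b)"
proof (rule ccontr)
  let ?R = "K - {x. a \<le> u \<bullet> x \<and> u \<bullet> x \<le> b}"
  assume "\<not> ?thesis"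
  then obtain p q where p: "p \<in> ?R" "u \<bullet> p < a" and q: "q \<in> ?R" "b < u \<bullet> q"
    by (auto simp: not_le)
  have "connected ((\<bullet>) u ` ?R)"
    by (intro connected_continuous_image convex_connected conv continuous_intros)
  then have "a \<in> (\<bullet>) u ` ?R"
    by (rule connectedD_interval[of _ "u \<bullet> p" "u \<bullet> q"]) (use p q \<open>a \<le> b\<close> in auto)
  with \<open>a \<le> b\<close> show False
    by auto
qed

lemma homothet_survives_plank:
  fixes C K P :: "(real ^ 'n) set"
  assumes C: "convex C" "bounded C"
    and P: "plank P v w"
    and conv: "convex (K - P)"
    and W: "width_in_direction v C \<noteq> 0"
    and \<mu>: "0 \<le> \<mu>" "\<mu> + w / width_in_direction v C < \<rho>"
    and K: "(\<lambda>x. t + \<rho> *\<^sub>R x) ` C \<subseteq> K"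
  shows "\<exists>s. (\<lambda>x. s + \<mu> *\<^sub>R x) ` C \<subseteq> K - P"
proof -
  let ?W = "width_in_direction v C"
  obtain u a b where u: "norm u = 1" and ab: "a \<le> b"
    and P_eq: "P = {x. a \<le> u \<bullet> x \<and> u \<bullet> x \<le> b}" and v: "v = span {u}" and w: "w = b - a"
    using P unfolding plank_def by blast
  have W_pos: "0 < ?W"
    using width_in_direction_nonneg[OF C(2) u] W v by simp
  have "0 \<le> w / ?W"
    using ab w W_pos by simp
  with \<mu> have less: "\<mu> < \<rho>"
    by linarith
  have "w / (\<rho> - \<mu>) < ?W"
    using \<mu> less W_pos by (simp add: field_simps)
  then obtain c d where cd: "c \<in> C" "d \<in> C" and "w / (\<rho> - \<mu>) < u \<bullet> c - u \<bullet> d"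
    using points_nearly_realising_width[OF u, of "w / (\<rho> - \<mu>)" C] ab w less v by auto
  then have gap: "b - a < (\<rho> - \<mu>) * (u \<bullet> c - u \<bullet> d)"
    using less w by (simp add: field_simps)
  from convex_diff_plank_one_sided[OF conv[unfolded P_eq] ab] show ?thesis
  proof
    assume "\<forall>x\<in>K. a \<le> u \<bullet> x"
    then have "\<And>x. x \<in> C \<Longrightarrow> a \<le> u \<bullet> (t + \<rho> *\<^sub>R x)"
      using K by blast
    from shrunken_homothet_above[OF C(1) cd \<mu>(1) less K this gap] show ?thesis
      unfolding P_eq by fastforce
  next
    \<comment> \<open>Reflecting the direction turns the plank upside down and exchanges \<open>c\<close> and \<open>d\<close>.\<close>
    assume "\<forall>x\<in>K. u \<bullet> x \<le> b"
    then have "\<And>x. x \<in> C \<Longrightarrow> - b \<le> (- u) \<bullet> (t + \<rho> *\<^sub>R x)"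
      using K by fastforce
    moreover have "- a - - b < (\<rho> - \<mu>) * ((- u) \<bullet> d - (- u) \<bullet> c)"
      using gap by simp
    ultimately show ?thesis
      using shrunken_homothet_above[OF C(1) cd(2,1) \<mu>(1) less K, of "- b" "- u" "- a"]
      unfolding P_eq by fastforce
  qed
qed

text \<open>
  The strict inequality leaves room for the small extra shrinking that each plank requires.
\<close>

lemma homothet_survives_planks:
  fixes C :: "(real ^ 'n) set" and m :: nat
  assumes C: "convex C" "bounded C" "C \<noteq> {}"
    and P: "\<And>i. i \<in> {1..m} \<Longrightarrow> plank (P i) (v i) (w i)"
    and W: "\<And>i. i \<in> {1..m} \<Longrightarrow> width_in_direction (v i) C \<noteq> 0"
    and conv: "\<And>j. 1 \<le> j \<Longrightarrow> j \<le> m \<Longrightarrow> convex (C - (\<Union>i\<in>{1..j}. P i))"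
    and "0 \<le> \<rho>" "\<rho> + (\<Sum>i=1..m. w i / width_in_direction (v i) C) < 1"
  shows "\<exists>t. (\<lambda>x. t + \<rho> *\<^sub>R x) ` C \<subseteq> C - (\<Union>i\<in>{1..m}. P i)"
  using P W conv assms(7,8)
proof (induction m arbitrary: \<rho>)
  case 0
  obtain c where "c \<in> C"
    using C(3) by blast
  with C(1) 0 have "(1 - \<rho>) *\<^sub>R c + \<rho> *\<^sub>R x \<in> C" if "x \<in> C" for x
    using that by (intro convexD) auto
  then show ?case
    by auto
next
  case (Suc m)
  let ?r = "\<lambda>i. w i / width_in_direction (v i) C"
  let ?K = "C - (\<Union>i\<in>{1..m}. P i)"
  have "\<rho> + ?r (Suc m) < 1 - (\<Sum>i=1..m. ?r i)"
    using Suc.prems(5) by simp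
  then obtain \<sigma> where \<sigma>: "\<rho> + ?r (Suc m) < \<sigma>" "\<sigma> < 1 - (\<Sum>i=1..m. ?r i)"
    using dense by blast
  have P: "plank (P (Suc m)) (v (Suc m)) (w (Suc m))"
    using Suc.prems(1) by simp
  obtain u where "norm u = 1" "v (Suc m) = span {u}"
    using P unfolding plank_def by blast
  then have "0 \<le> ?r (Suc m)"
    using width_in_direction_nonneg[OF C(2)] plank_width_nonneg[OF P] by simp
  then have "0 \<le> \<sigma>" "\<sigma> + (\<Sum>i=1..m. ?r i) < 1"
    using \<sigma> Suc.prems(4) by linarith+
  then obtain t where t: "(\<lambda>x. t + \<sigma> *\<^sub>R x) ` C \<subseteq> ?K"
    using Suc.IH[of \<sigma>] Suc.prems(1-3) by auto
  have remainder: "C - (\<Union>i\<in>{1..Suc m}. P i) = ?K - P (Suc m)"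
    by (auto simp: atLeastAtMostSuc_conv)
  then have "convex (?K - P (Suc m))"
    using Suc.prems(3)[of "Suc m"] by simp
  then show ?case
    unfolding remainder
    using homothet_survives_plank[OF C(1,2) P _ _ Suc.prems(4) \<sigma>(1) t] Suc.prems(2)
    by simp
qed

section \<open>The sum of the relative widths\<close>

theorem theorem1:
  fixes C :: "(real ^ 'n) set"
    and P v :: "nat \<Rightarrow> (real ^ 'n) set"
    and w :: "nat \<Rightarrow> real"
    and k :: nat
  assumes "convex C"
    and "bounded C"
    and "k \<ge> 1"
    and "\<And>i. i \<in> {1..k} \<Longrightarrow> plank (P i) (v i) (w i)"
    and "C \<subseteq> (\<Union>i\<in>{1..k}. P i)"
    and "\<And>m. 1 \<le> m \<Longrightarrow> m \<le> k \<Longrightarrow> convex (C - (\<Union>i\<in>{1..m}. P i))"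
  shows "(\<Sum>i=1..k. relative_width (w i) (v i) C) \<ge> 1"
proof (cases "\<exists>i\<in>{1..k}. width_in_direction (v i) C = 0")
  case True
  then have "(\<Sum>i=1..k. relative_width (w i) (v i) C) = \<infinity>"
    by (auto simp: sum_Pinfty relative_width_def)
  then show ?thesis
    by simp
next
  case False
  let ?r = "\<lambda>i. w i / width_in_direction (v i) C"
  have nonempty: "C \<noteq> {}"
    using False width_in_direction_empty assms(3,4) by force
  have "1 \<le> (\<Sum>i=1..k. ?r i)"
  proof (rule ccontr)
    assume "\<not> ?thesis"
    then obtain t where "(\<lambda>x. t + 0 *\<^sub>R x) ` C \<subseteq> C - (\<Union>i\<in>{1..k}. P i)"
      using homothet_survives_planks[of C k P v w 0] assms(1,2,4,6) nonempty False
      by auto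
    with nonempty assms(5) show False
      by auto
  qed
  moreover have "(\<Sum>i=1..k. relative_width (w i) (v i) C) = (\<Sum>i=1..k. ereal (?r i))"
    using False by (intro sum.cong) (auto simp: relative_width_def)
  ultimately show ?thesis
    by simp
qed

end
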